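(* Let $\mathbf X\in\mathbb R^{n\times d}$ have full column rank, $\mathbf y\in\mathbb R^n$, and let $h_\lambda:\mathbb R^d\to\mathbb R$ be nonconvex and Fréchet subdifferentiable, with $L_h$-smooth Fréchet subdifferential, i.e. $\sup_{\mathbf u\in\tilde\partial h_\lambda(\mathbf x),\,\mathbf v\in\tilde\partial h_\lambda(\mathbf y')}\|\mathbf u-\mathbf v\|_2\le L_h\|\mathbf x-\mathbf y'\|_2$ for all $\mathbf x,\mathbf y'\in\mathbb R^d$. Suppose $0<\varepsilon<\varepsilon_0<1$, where $\varepsilon_0$ is a small positive constant, $0<\delta<1$, and $\mathbf P$ is drawn from an $(\varepsilon,\delta)$ oblivious $\ell^2$-subspace embedding over $\tilde n\times n$ matrices; put $\tilde{\mathbf X}=\mathbf P\mathbf X$. Let $\boldsymbol\beta^*$ be any critical point of $f(\boldsymbol\beta)=\frac12\|\mathbf y-\mathbf X\boldsymbol\beta\|_2^2+h_\lambda(\boldsymbol\beta)$ and $\tilde{\boldsymbol\beta}^*$ any critical point of $\tilde f(\boldsymbol\beta)=\frac12\boldsymbol\beta^\top\tilde{\mathbf X}^\top\tilde{\mathbf X}\boldsymbol\beta-\langle\mathbf y,\mathbf X\boldsymbol\beta\rangle+h_\lambda(\boldsymbol\beta)$. If $\sigma_{\min}^2(\mathbf X)>L_h$ and $0<\varepsilon<1-\frac{L_h}{\sigma_{\min}^2(\mathbf X)}$, then with probability at least $1-\delta$, $$\|\tilde{\boldsymbol\beta}^*-\boldsymbol\beta^*\|_{\mathbf X}\le\frac{\varepsilon}{(1-\varepsilon)-\frac{L_h}{\sigma_{\min}^2(\mathbf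 X)}}\,\|\boldsymbol\beta^*\|_{\mathbf X}.$$
   Context: Notation: $\|\mathbf u\|_{\mathbf X}=\|\mathbf X\mathbf u\|_2$; $\sigma_{\min}(\mathbf X)$ is the smallest singular value of $\mathbf X$. Fréchet subdifferential: for a proper lower semicontinuous $f$ and $\mathbf x\in\mathrm{dom} f$, $\tilde\partial f(\mathbf x)$ is the set of all $\mathbf u\in\mathbb R^d$ with $\liminf_{\mathbf y\ne\mathbf x,\mathbf y\to\mathbf x}\frac{f(\mathbf y)-f(\mathbf x)-\langle\mathbf u,\mathbf y-\mathbf x\rangle}{\|\mathbf y-\mathbf x\|_2}\ge0$. Limiting subdifferential: $\partial f(\mathbf x)=\{\mathbf u:\exists\,\mathbf x^k\to\mathbf x,\ f(\mathbf x^k)\to f(\mathbf x),\ \tilde{\mathbf u}^k\in\tilde\partial f(\mathbf x^k),\ \tilde{\mathbf u}^k\to\mathbf u\}$. A point $\mathbf x$ is a critical point of $f$ if $\mathbf 0\in\partial f(\mathbf x)$. A distribution $\mathcal P$ over $\tilde n\times n$ matrices (where $\tilde n$ is a function of $n,d,\varepsilon,\delta$) is an $(\varepsilon,\delta)$ oblivious $\ell^2$-subspace embedding if for any fixed $n\times d$ matrix $\mathbf X$, with probability at least $1-\delta$ a matrix $\mathbf P\sim\mathcal P$ satisfies $(1-\varepsilon)\|\mathbf X\boldsymbol\beta\|_2^2\le\|\mathbf P\mathbf X\boldsymbol\beta\|_2^2\le(1+\varepsilon)\|\mathbf X\boldsymbol\beta\|_2^2$ for all $\boldsymbol\beta\in\mathbb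 R^d$. *)

theory Defs
  imports "HOL-Probability.Probability"
begin

text \<open>The functions considered below are real-valued, so properness and \<open>x \<in> dom f\<close> are automatic.
  The limit inferior is taken in the extended reals.\<close>

definition frechet_subdifferential :: "('a::real_inner \<Rightarrow> real) \<Rightarrow> 'a \<Rightarrow> 'a set" where
  "frechet_subdifferential f x =
     {u. Liminf (at x) (\<lambda>y. ereal ((f y - f x - u \<bullet> (y - x)) / norm (y - x))) \<ge> 0}"

definition limiting_subdifferential :: "('a::real_inner \<Rightarrow> real) \<Rightarrow> 'a \<Rightarrow> 'a set" where
  "limiting_subdifferential f x =
     {u. \<exists>xs us. xs \<longlonglongrightarrow> x \<and> (\<lambda>k. f (xs k)) \<longlonglongrightarrow> f x \<and>
           (\<forall>k::nat. us k \<in> frechet_subdifferential f (xs k)) \<and> us \<longlonglongrightarrow> u}"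

definition critical_point :: "('a::real_inner \<Rightarrow> real) \<Rightarrow> 'a \<Rightarrow> bool" where
  "critical_point f x \<longleftrightarrow> 0 \<in> limiting_subdifferential f x"

definition frechet_subdifferentiable :: "('a::real_inner \<Rightarrow> real) \<Rightarrow> bool" where
  "frechet_subdifferentiable f \<longleftrightarrow> (\<forall>x. frechet_subdifferential f x \<noteq> {})"

definition smooth_frechet_subdifferential :: "real \<Rightarrow> ('a::real_inner \<Rightarrow> real) \<Rightarrow> bool" where
  "smooth_frechet_subdifferential L f \<longleftrightarrow>
     (\<forall>x y. (SUP (u, v) \<in> frechet_subdifferential f x \<times> frechet_subdifferential f y.
               ereal (norm (u - v))) \<le> ereal (L * norm (x - y)))"

text \<open>Singular values as the nonnegative square roots of the eigenvalues of the Gram matrix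
  \<open>X\<^sup>T X\<close>. A matrix with more columns than rows also gets the value 0 here; this does not
  occur for full column rank.\<close>

definition singular_values :: "real^'d^'n \<Rightarrow> real set" where
  "singular_values X =
     {s. s \<ge> 0 \<and> (\<exists>v. v \<noteq> 0 \<and> (transpose X ** X) *v v = s\<^sup>2 *\<^sub>R v)}"

definition sigma_min :: "real^'d^'n \<Rightarrow> real" where
  "sigma_min X = Min (singular_values X)"

definition data_norm :: "real^'d^'n \<Rightarrow> real^'d \<Rightarrow> real" where
  "data_norm X u = norm (X *v u)"

text \<open>A distribution over matrices is a Borel probability measure on them; the type argument
  \<open>TYPE('d)\<close> carries the number of columns of the embedded matrices.\<close>

definition oblivious_subspace_embedding ::
  "real \<Rightarrow> real \<Rightarrow> 'd::finite itself \<Rightarrow> (real^'n^'m) measure \<Rightarrow> bool" where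
  "oblivious_subspace_embedding \<epsilon> \<delta> (_ :: 'd::finite itself) D \<longleftrightarrow>
     prob_space D \<and> sets D = sets borel \<and>
     (\<forall>X :: real^'d^'n.
        \<P>(P in D. \<forall>\<beta>. (1 - \<epsilon>) * (norm (X *v \<beta>))\<^sup>2 \<le> (norm ((P ** X) *v \<beta>))\<^sup>2 \<and>
                      (norm ((P ** X) *v \<beta>))\<^sup>2 \<le> (1 + \<epsilon>) * (norm (X *v \<beta>))\<^sup>2) \<ge> 1 - \<delta>)"

definition objective ::
  "real^'d^'n \<Rightarrow> real^'n \<Rightarrow> (real^'d \<Rightarrow> real) \<Rightarrow> real^'d \<Rightarrow> real" where
  "objective X y h \<beta> = 1/2 * (norm (y - X *v \<beta>))\<^sup>2 + h \<beta>"

definition sketched_objective ::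
  "real^'d^'m \<Rightarrow> real^'d^'n \<Rightarrow> real^'n \<Rightarrow> (real^'d \<Rightarrow> real) \<Rightarrow> real^'d \<Rightarrow> real" where
  "sketched_objective Xt X y h \<beta> =
     1/2 * (\<beta> \<bullet> ((transpose Xt ** Xt) *v \<beta>)) - y \<bullet> (X *v \<beta>) + h \<beta>"

end

(* Smoothness makes the Frechet subdifferential of h a singleton {g x} with g
   L-Lipschitz, so by the sum rule critical points are the zeros of the gradient of the quadratic
   part plus g. Subtracting the two equations and pairing with the error v = bt - bs, the
   embedding property (polarized) and sigma_min^2 |v|^2 <= |X v|^2 give the bound.
   The event is Borel because its complement is the projection of the intersection of a closed and
   an open set, hence sigma-compact. *)

theory Submission
  imports Defs
begin

section \<open>Subdifferentials of smooth perturbations\<close>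

text \<open>Trades the \<open>Liminf\<close> in the extended reals for a real epsilon condition, so
  that difference quotients can be added by plain arithmetic.\<close>

lemma frechet_subdifferential_iff:
  "u \<in> frechet_subdifferential f x \<longleftrightarrow>
     (\<forall>e>0. eventually (\<lambda>y. (f y - f x - u \<bullet> (y - x)) / norm (y - x) > - e) (at x))"
proof
  assume u: "u \<in> frechet_subdifferential f x"
  show "\<forall>e>0. eventually (\<lambda>y. (f y - f x - u \<bullet> (y - x)) / norm (y - x) > - e) (at x)"
  proof (intro allI impI)
    fix e :: real assume "e > 0"
    then have "ereal (- e) < 0" by simp
    then have "eventually (\<lambda>y. ereal (- e) < ereal ((f y - f x - u \<bullet> (y - x)) / norm (y - x))) (at x)"
      using u unfolding frechet_subdifferential_def le_Liminf_iff by blast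
    then show "eventually (\<lambda>y. (f y - f x - u \<bullet> (y - x)) / norm (y - x) > - e) (at x)"
      by simp
  qed
next
  assume *: "\<forall>e>0. eventually (\<lambda>y. (f y - f x - u \<bullet> (y - x)) / norm (y - x) > - e) (at x)"
  have "eventually (\<lambda>y. c < ereal ((f y - f x - u \<bullet> (y - x)) / norm (y - x))) (at x)"
    if "c < 0" for c :: ereal
  proof -
    \<comment> \<open>The bound \<open>c\<close> may be minus infinity, so a negative real above it
      is interposed to serve as -e.\<close>
    obtain r where r: "c < ereal r" "ereal r < 0"
      using ereal_dense2[OF \<open>c < 0\<close>] by blast
    then have "- r > 0" by simp
    with * have "eventually (\<lambda>y. (f y - f x - u \<bullet> (y - x)) / norm (y - x) > - (- r)) (at x)"
      by blast
    then show ?thesis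
    proof eventually_elim
      case (elim y)
      then have "ereal r < ereal ((f y - f x - u \<bullet> (y - x)) / norm (y - x))" by simp
      then show ?case using r(1) by (meson less_trans)
    qed
  qed
  then show "u \<in> frechet_subdifferential f x"
    unfolding frechet_subdifferential_def le_Liminf_iff by blast
qed

text \<open>One inclusion of the sum rule: the difference quotient of \<open>q\<close> tends to 0,
  so it and the quotient of \<open>h\<close> can each be charged e/2.\<close>

lemma frechet_subdifferential_add_differentiable_aux:
  fixes q h :: "'a::real_inner \<Rightarrow> real"
  assumes q: "(q has_derivative (\<lambda>v. a \<bullet> v)) (at x)"
    and u: "u \<in> frechet_subdifferential h x"
  shows "a + u \<in> frechet_subdifferential (\<lambda>z. q z + h z) x"
  unfolding frechet_subdifferential_iff
proof (intro allI impI)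
  fix e :: real assume e: "e > 0"
  have "((\<lambda>z. (q z - q x - a \<bullet> (z - x)) / norm (z - x)) \<longlongrightarrow> 0) (at x)"
    using q unfolding has_derivative_iff_norm
    by (intro tendsto_norm_zero_cancel[of "\<lambda>z. (q z - q x - a \<bullet> (z - x)) / norm (z - x)"]) simp
  then have "eventually (\<lambda>z. (q z - q x - a \<bullet> (z - x)) / norm (z - x) > - (e/2)) (at x)"
    using e by (intro order_tendstoD(1)) auto
  moreover have "eventually (\<lambda>z. (h z - h x - u \<bullet> (z - x)) / norm (z - x) > - (e/2)) (at x)"
    using u e unfolding frechet_subdifferential_iff by simp
  ultimately show "eventually (\<lambda>z. (q z + h z - (q x + h x) - (a + u) \<bullet> (z - x)) / norm (z - x) > - e) (at x)"
  proof eventually_elim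
    case (elim z)
    have "(q z + h z - (q x + h x) - (a + u) \<bullet> (z - x)) / norm (z - x)
        = (q z - q x - a \<bullet> (z - x)) / norm (z - x) + (h z - h x - u \<bullet> (z - x)) / norm (z - x)"
      by (simp add: add_divide_distrib[symmetric] inner_add_left)
    then show ?case using elim by linarith
  qed
qed

text \<open>The reverse inclusion is the same one again, applied to the sum \<open>q + h\<close>
  with the differentiable perturbation \<open>- q\<close>.\<close>

lemma frechet_subdifferential_add_differentiable:
  fixes q h :: "'a::real_inner \<Rightarrow> real"
  assumes q: "(q has_derivative (\<lambda>v. a \<bullet> v)) (at x)"
  shows "u \<in> frechet_subdifferential (\<lambda>z. q z + h z) x \<longleftrightarrow> u - a \<in> frechet_subdifferential h x"
proof
  assume "u \<in> frechet_subdifferential (\<lambda>z. q z + h z) x"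
  moreover have "((\<lambda>z. - q z) has_derivative (\<lambda>v. (- a) \<bullet> v)) (at x)"
    using has_derivative_minus[OF q] by simp
  ultimately show "u - a \<in> frechet_subdifferential h x"
    using frechet_subdifferential_add_differentiable_aux[of "\<lambda>z. - q z" "- a" x u "\<lambda>z. q z + h z"]
    by simp
next
  assume "u - a \<in> frechet_subdifferential h x"
  then show "u \<in> frechet_subdifferential (\<lambda>z. q z + h z) x"
    using frechet_subdifferential_add_differentiable_aux[OF q, of "u - a" h] by simp
qed

text \<open>Smoothness at two equal points forces any two subgradients there to coincide, and
  subdifferentiability supplies one; at distinct points the same estimate is the Lipschitz bound for
  \<open>g\<close>.\<close>

lemma smooth_frechet_subdifferential_singleton:
  fixes h :: "'a::real_inner \<Rightarrow> real"
  assumes "frechet_subdifferentiable h" and "smooth_frechet_subdifferential L h"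
  obtains g where "\<And>x. frechet_subdifferential h x = {g x}"
    and "\<And>x y. norm (g x - g y) \<le> L * norm (x - y)"
proof -
  have le: "norm (u - v) \<le> L * norm (x - y)"
    if "u \<in> frechet_subdifferential h x" "v \<in> frechet_subdifferential h y" for u v x y
  proof -
    have "ereal (norm (u - v)) \<le> (SUP (u, v) \<in> frechet_subdifferential h x \<times> frechet_subdifferential h y.
               ereal (norm (u - v)))"
      by (rule SUP_upper2[of "(u, v)"]) (use that in auto)
    also have "\<dots> \<le> ereal (L * norm (x - y))"
      using assms(2) unfolding smooth_frechet_subdifferential_def by blast
    finally show ?thesis by simp
  qed
  define g where "g x = (SOME u. u \<in> frechet_subdifferential h x)" for x
  have g: "g x \<in> frechet_subdifferential h x" for x
    using assms(1) unfolding g_def frechet_subdifferentiable_def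
    by (metis ex_in_conv someI_ex)
  show ?thesis
  proof
    show "frechet_subdifferential h x = {g x}" for x
      using g[of x] le[of _ x "g x" x] by fastforce
    show "norm (g x - g y) \<le> L * norm (x - y)" for x y
      using g le by blast
  qed
qed

text \<open>The Frechet subdifferential of the sum is the single value of the continuous map
  \<open>G + g\<close>, so limits of subgradients add nothing new. Conversely, constant sequences
  witness a Frechet subgradient as a limiting one.\<close>

lemma critical_point_add_differentiable_iff:
  fixes q h :: "'a::real_inner \<Rightarrow> real"
  assumes q: "\<And>x. (q has_derivative (\<lambda>v. G x \<bullet> v)) (at x)"
    and G: "continuous_on UNIV G"
    and g: "\<And>x. frechet_subdifferential h x = {g x}" "continuous_on UNIV g"
  shows "critical_point (\<lambda>z. q z + h z) x \<longleftrightarrow> G x + g x = 0"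
proof -
  have sub: "u \<in> frechet_subdifferential (\<lambda>z. q z + h z) z \<longleftrightarrow> u = G z + g z" for u z
    unfolding frechet_subdifferential_add_differentiable[OF q] g(1) by (auto simp: algebra_simps)
  show ?thesis
  proof
    assume "critical_point (\<lambda>z. q z + h z) x"
    then obtain xs us where xs: "xs \<longlonglongrightarrow> x"
      and us: "\<forall>k::nat. us k \<in> frechet_subdifferential (\<lambda>z. q z + h z) (xs k)" "us \<longlonglongrightarrow> 0"
      unfolding critical_point_def limiting_subdifferential_def by blast
    have "isCont (\<lambda>z. G z + g z) x"
      using G g(2) by (simp add: continuous_on_eq_continuous_at)
    then have "(\<lambda>k. G (xs k) + g (xs k)) \<longlonglongrightarrow> G x + g x"
      using xs by (rule isCont_tendsto_compose)
    moreover have "us = (\<lambda>k. G (xs k) + g (xs k))"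
      using us(1) by (simp add: sub fun_eq_iff)
    ultimately show "G x + g x = 0"
      using us(2) LIMSEQ_unique by blast
  next
    assume "G x + g x = 0"
    then have "0 \<in> frechet_subdifferential (\<lambda>z. q z + h z) x"
      by (simp add: sub)
    then show "critical_point (\<lambda>z. q z + h z) x"
      unfolding critical_point_def limiting_subdifferential_def
      by (intro CollectI exI[of _ "\<lambda>_. x"] exI[of _ "\<lambda>_. 0"]) auto
  qed
qed

section \<open>Matrix calculus and the stationarity equations of both objectives\<close>

lemma continuous_on_matrix_matrix_mult [continuous_intros]:
  fixes f :: "'a::topological_space \<Rightarrow> real^'n^'m" and g :: "'a \<Rightarrow> real^'k^'n"
  assumes "continuous_on S f" "continuous_on S g"
  shows "continuous_on S (\<lambda>x. f x ** g x)"
  unfolding matrix_matrix_mult_def using assms by (intro continuous_intros)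

lemma continuous_on_matrix_vector_mult [continuous_intros]:
  fixes f :: "'a::topological_space \<Rightarrow> real^'n^'m" and g :: "'a \<Rightarrow> real^'n"
  assumes "continuous_on S f" "continuous_on S g"
  shows "continuous_on S (\<lambda>x. f x *v g x)"
  unfolding matrix_vector_mult_def using assms by (intro continuous_intros)

lemma continuous_on_transpose [continuous_intros]:
  fixes f :: "'a::topological_space \<Rightarrow> real^'n^'m"
  assumes "continuous_on S f"
  shows "continuous_on S (\<lambda>x. transpose (f x))"
  unfolding transpose_def using assms by (intro continuous_intros)

lemma inner_transpose_mult:
  fixes X :: "real^'d^'n"
  shows "(transpose X *v a) \<bullet> v = a \<bullet> (X *v v)"
    and "v \<bullet> (transpose X *v a) = (X *v v) \<bullet> a"
  by (simp_all add: dot_lmul_matrix inner_commute[of v] inner_commute[of a])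

lemma has_derivative_matrix_vector_mult:
  fixes X :: "real^'d^'n"
  shows "((\<lambda>v. X *v v) has_derivative (\<lambda>v. X *v v)) (at x)"
  by (rule bounded_linear_imp_has_derivative) (rule matrix_vector_mul_bounded_linear)

lemma critical_point_objective_iff:
  fixes X :: "real^'d^'n"
  assumes "\<And>x. frechet_subdifferential h x = {g x}" "continuous_on UNIV g"
  shows "critical_point (objective X y h) \<beta> \<longleftrightarrow>
    transpose X *v (X *v \<beta> - y) + g \<beta> = 0"
proof -
  have "((\<lambda>z. 1/2 * (norm (y - X *v z))\<^sup>2) has_derivative
      (\<lambda>v. (transpose X *v (X *v \<beta> - y)) \<bullet> v)) (at \<beta>)" for \<beta>
    unfolding power2_norm_eq_inner
    by (rule has_derivative_eq_rhs, (rule derivative_intros has_derivative_matrix_vector_mult)+)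
      (simp add: fun_eq_iff inner_transpose_mult inner_commute inner_diff_right
        del: transpose_matrix_vector)
  moreover have "continuous_on UNIV (\<lambda>\<beta>. transpose X *v (X *v \<beta> - y))"
    by (intro continuous_intros)
  ultimately show ?thesis
    using critical_point_add_differentiable_iff[of "\<lambda>z. 1/2 * (norm (y - X *v z))\<^sup>2"
        "\<lambda>\<beta>. transpose X *v (X *v \<beta> - y)" h g \<beta>] assms
    unfolding objective_def by blast
qed

text \<open>Here \<open>Y\<close> stands for \<open>P ** X\<close>. Only the quadratic term is
  sketched, so the data term stays \<open>transpose X *v y\<close>, exactly as in the equation for
  \<open>objective\<close>, and will cancel on subtraction.\<close>

lemma critical_point_sketched_objective_iff:
  fixes X :: "real^'d^'n" and Y :: "real^'d^'m"
  assumes "\<And>x. frechet_subdifferential h x = {g x}" "continuous_on UNIV g"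
  shows "critical_point (sketched_objective Y X y h) \<beta> \<longleftrightarrow>
    transpose Y *v (Y *v \<beta>) - transpose X *v y + g \<beta> = 0"
proof -
  have eq: "\<beta> \<bullet> ((transpose Y ** Y) *v \<beta>) = (Y *v \<beta>) \<bullet> (Y *v \<beta>)" for \<beta>
    by (simp add: matrix_vector_mul_assoc[symmetric] inner_transpose_mult del: transpose_matrix_vector)
  have "((\<lambda>z. 1/2 * ((Y *v z) \<bullet> (Y *v z)) - y \<bullet> (X *v z)) has_derivative
      (\<lambda>v. (transpose Y *v (Y *v \<beta>) - transpose X *v y) \<bullet> v)) (at \<beta>)" for \<beta>
    by (rule has_derivative_eq_rhs, (rule derivative_intros has_derivative_matrix_vector_mult)+)
      (simp add: fun_eq_iff inner_transpose_mult inner_diff_right inner_commute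
        del: transpose_matrix_vector)
  moreover have "continuous_on UNIV (\<lambda>\<beta>. transpose Y *v (Y *v \<beta>) - transpose X *v y)"
    by (intro continuous_intros)
  ultimately show ?thesis
    using critical_point_add_differentiable_iff[of "\<lambda>z. 1/2 * ((Y *v z) \<bullet> (Y *v z)) - y \<bullet> (X *v z)"
        "\<lambda>\<beta>. transpose Y *v (Y *v \<beta>) - transpose X *v y" h g \<beta>] assms
    unfolding sketched_objective_def eq by blast
qed

section \<open>The smallest singular value\<close>

text \<open>Needed for \<open>Min\<close> in \<open>sigma_min\<close> to behave as a minimum.
  Distinct nonnegative values have distinct squares, eigenvectors of the symmetric Gram matrix for
  distinct eigenvalues are orthogonal, and orthogonal nonzero vectors are independent.\<close>

lemma finite_singular_values:
  fixes X :: "real^'d^'n"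
  shows "finite (singular_values X)"
proof -
  have "\<forall>s\<in>singular_values X. \<exists>v. v \<noteq> 0 \<and> (transpose X ** X) *v v = s\<^sup>2 *\<^sub>R v"
    unfolding singular_values_def by blast
  then obtain w where w: "\<And>s. s \<in> singular_values X \<Longrightarrow> w s \<noteq> 0"
    "\<And>s. s \<in> singular_values X \<Longrightarrow> (transpose X ** X) *v w s = s\<^sup>2 *\<^sub>R w s"
    by metis
  have orth: "w s \<bullet> w t = 0" if "s \<in> singular_values X" "t \<in> singular_values X" "s \<noteq> t" for s t
  proof -
    have "((transpose X ** X) *v w s) \<bullet> w t = w s \<bullet> ((transpose X ** X) *v w t)"
      by (simp add: matrix_vector_mul_assoc[symmetric] inner_transpose_mult
          del: transpose_matrix_vector)
    then have "s\<^sup>2 * (w s \<bullet> w t) = t\<^sup>2 * (w s \<bullet> w t)"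
      using that by (simp add: w(2))
    moreover have "s\<^sup>2 \<noteq> t\<^sup>2"
      using that by (auto simp: singular_values_def power2_eq_iff_nonneg)
    ultimately show ?thesis by simp
  qed
  have "inj_on w (singular_values X)"
    using orth w(1) by (intro inj_onI) (metis inner_eq_zero_iff)
  moreover have "pairwise orthogonal (w ` singular_values X)"
    using orth by (auto simp: pairwise_def orthogonal_def)
  then have "finite (w ` singular_values X)"
    using w(1) by (intro independent_imp_finite pairwise_orthogonal_independent) auto
  ultimately show ?thesis
    using finite_imageD by blast
qed

text \<open>By compactness \<open>norm (X *v v)\<close> attains a minimum on the unit sphere, and a
  minimizer is an eigenvector of the Gram matrix. This also shows that
  \<open>singular_values X\<close> is nonempty.\<close>

lemma min_norm_singular_value:
  fixes X :: "real^'d^'n"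
  obtains s where "s \<in> singular_values X" "\<And>v. s * norm v \<le> norm (X *v v)"
proof -
  have "\<exists>v0\<in>sphere (0::real^'d) 1. \<forall>v\<in>sphere 0 1. norm (X *v v0) \<le> norm (X *v v)"
    by (intro continuous_attains_inf compact_sphere continuous_intros) auto
  then obtain v0 :: "real^'d" where v0: "norm v0 = 1"
    and min: "\<And>v. norm v = 1 \<Longrightarrow> norm (X *v v0) \<le> norm (X *v v)"
    by auto
  define s where "s = norm (X *v v0)"
  have le: "s * norm v \<le> norm (X *v v)" for v
  proof (cases "v = 0")
    case False
    then have "s \<le> norm (X *v ((1 / norm v) *\<^sub>R v))"
      unfolding s_def by (intro min) simp
    also have "\<dots> = norm (X *v v) / norm v"
      using False by (simp add: scaleR_matrix_vector_assoc[symmetric] matrix_vector_mult_scaleR)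
    finally show ?thesis using False by (simp add: field_simps)
  qed simp
  have s0: "s \<ge> 0" by (simp add: s_def)
  have psd: "(norm (X *v v))\<^sup>2 - s\<^sup>2 * (norm v)\<^sup>2 \<ge> 0" for v
    using power_mono[OF le[of v], of 2] s0 by (simp add: power_mult_distrib)
  \<comment> \<open>\<open>v0\<close> minimizes the positive semidefinite form of \<open>X\<^sup>T X - s\<^sup>2 I\<close>, so this matrix kills it.\<close>
  define r where "r = (transpose X ** X) *v v0 - s\<^sup>2 *\<^sub>R v0"
  define b where "b = (norm (X *v r))\<^sup>2 - s\<^sup>2 * (norm r)\<^sup>2"
  \<comment> \<open>The form is expanded at \<open>v0\<close> in direction \<open>r\<close>. It
    vanishes at \<open>v0\<close>, and its linear coefficient there is twice the squared norm of
    \<open>r\<close>.\<close>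
  have quad: "2 * t * (norm r)\<^sup>2 + t\<^sup>2 * b \<ge> 0" for t
  proof -
    have "(norm (X *v (v0 + t *\<^sub>R r)))\<^sup>2 - s\<^sup>2 * (norm (v0 + t *\<^sub>R r))\<^sup>2
      = ((norm (X *v v0))\<^sup>2 - s\<^sup>2 * (norm v0)\<^sup>2)
        + 2 * t * ((X *v v0) \<bullet> (X *v r) - s\<^sup>2 * (v0 \<bullet> r)) + t\<^sup>2 * b"
      unfolding b_def power2_norm_eq_inner
      by (simp add: matrix_vector_right_distrib matrix_vector_mult_scaleR inner_add_left
          inner_add_right inner_commute algebra_simps power2_eq_square)
    also have "(X *v v0) \<bullet> (X *v r) - s\<^sup>2 * (v0 \<bullet> r) = r \<bullet> r"
      by (subst (4) r_def)
        (simp add: inner_diff_right matrix_vector_mul_assoc[symmetric] inner_transpose_mult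
          inner_commute del: transpose_matrix_vector)
    finally show ?thesis
      using psd[of "v0 + t *\<^sub>R r"] v0 by (simp add: s_def power2_norm_eq_inner)
  qed
  have "r = 0"
  proof (rule ccontr)
    assume "r \<noteq> 0"
    define a where "a = (norm r)\<^sup>2"
    have a: "a > 0" using \<open>r \<noteq> 0\<close> by (simp add: a_def)
    have b: "b \<ge> 0" using psd by (simp add: b_def)
    \<comment> \<open>The quadratic \<open>2 * t * a + t\<^sup>2 * b\<close> has its minimum at -a/b
      when b > 0; the denominator b + 1 also covers b = 0 and still makes the value
      negative.\<close>
    define t where "t = - a / (b + 1)"
    have t: "(b + 1) * t = - a" using b by (simp add: t_def)
    have "0 \<le> (b + 1)\<^sup>2 * (2 * t * a + t\<^sup>2 * b)"
      using quad[of t] by (intro mult_nonneg_nonneg) (auto simp: a_def)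
    also have "\<dots> = 2 * (b + 1) * ((b + 1) * t) * a + ((b + 1) * t)\<^sup>2 * b"
      by (simp add: algebra_simps power2_eq_square)
    also have "\<dots> = - (a\<^sup>2 * (b + 2))"
      unfolding t by (simp add: algebra_simps power2_eq_square)
    finally show False
      using a b by (simp add: mult_le_0_iff)
  qed
  then have "s \<in> singular_values X"
    using v0 s0 unfolding singular_values_def r_def by (auto intro!: exI[of _ v0])
  then show ?thesis using le that by blast
qed

text \<open>\<open>sigma_min X\<close> is at most the singular value from
  \<open>min_norm_singular_value\<close>, and it is nonnegative as a member of the set, so the bound
  may be squared.\<close>

lemma sigma_min_le:
  fixes X :: "real^'d^'n"
  shows "(sigma_min X)\<^sup>2 * (norm v)\<^sup>2 \<le> (norm (X *v v))\<^sup>2"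
proof -
  obtain s where s: "s \<in> singular_values X" "\<And>v. s * norm v \<le> norm (X *v v)"
    using min_norm_singular_value[of X] by blast
  have "sigma_min X \<le> s"
    unfolding sigma_min_def using s(1) by (intro Min_le finite_singular_values)
  moreover have "sigma_min X \<in> singular_values X"
    unfolding sigma_min_def using s(1) by (intro Min_in finite_singular_values) auto
  then have "sigma_min X \<ge> 0"
    by (simp add: singular_values_def)
  ultimately have "(sigma_min X * norm v)\<^sup>2 \<le> (norm (X *v v))\<^sup>2"
    by (intro power_mono order_trans[OF mult_right_mono s(2)]) auto
  then show ?thesis by (simp add: power_mult_distrib)
qed

section \<open>The deterministic bound\<close>

text \<open>A Cauchy-Schwarz inequality for the difference of the forms induced by \<open>T\<close>
  and \<open>S\<close>; it will control the cross term between the error and \<beta>s.\<close>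

lemma near_isometry_inner:
  fixes S :: "'a::real_vector \<Rightarrow> 'b::real_inner" and T :: "'a \<Rightarrow> 'c::real_inner"
  assumes S: "linear S" and T: "linear T"
    and near: "\<And>v. \<bar>(norm (T v))\<^sup>2 - (norm (S v))\<^sup>2\<bar> \<le> \<epsilon> * (norm (S v))\<^sup>2"
  shows "\<bar>T a \<bullet> T b - S a \<bullet> S b\<bar> \<le> \<epsilon> * norm (S a) * norm (S b)"
proof (cases "S a = 0 \<or> S b = 0")
  case True
  \<comment> \<open>Where \<open>S\<close> vanishes, \<open>near\<close> makes \<open>T\<close>
    vanish too, so both inner products are 0.\<close>
  then show ?thesis using near[of a] near[of b] by auto
next
  case False
  \<comment> \<open>Polarization loses the product structure; rescaling to equal norms recovers it.\<close>
  define p r where "p = norm (S a)" and "r = norm (S b)"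
  define a' b' where "a' = r *\<^sub>R a" and "b' = p *\<^sub>R b"
  have "p * r > 0" using False by (simp add: p_def r_def)
  have "4 * (T a' \<bullet> T b' - S a' \<bullet> S b')
      = ((norm (T (a' + b')))\<^sup>2 - (norm (S (a' + b')))\<^sup>2)
        - ((norm (T (a' - b')))\<^sup>2 - (norm (S (a' - b')))\<^sup>2)"
    unfolding power2_norm_eq_inner
    by (simp add: linear_add[OF S] linear_add[OF T] linear_diff[OF S] linear_diff[OF T]
        inner_add_left inner_add_right inner_diff_left inner_diff_right inner_commute)
  then have "\<bar>4 * (T a' \<bullet> T b' - S a' \<bullet> S b')\<bar>
      \<le> \<epsilon> * (norm (S (a' + b')))\<^sup>2 + \<epsilon> * (norm (S (a' - b')))\<^sup>2"
    using near[of "a' + b'"] near[of "a' - b'"] by linarith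
  also have "\<dots> = 2 * \<epsilon> * ((norm (S a'))\<^sup>2 + (norm (S b'))\<^sup>2)"
    unfolding power2_norm_eq_inner
    by (simp add: linear_add[OF S] linear_diff[OF S] inner_add_left inner_add_right
        inner_diff_left inner_diff_right inner_commute algebra_simps)
  \<comment> \<open>Both rescaled vectors have \<open>S\<close>-norm \<open>p * r\<close>; one such
    factor will cancel against the scaling on the left.\<close>
  also have "\<dots> = 4 * ((p * r) * (\<epsilon> * p * r))"
    by (simp add: a'_def b'_def linear_cmul[OF S] p_def r_def power2_eq_square algebra_simps)
  also have "T a' \<bullet> T b' - S a' \<bullet> S b' = (p * r) * (T a \<bullet> T b - S a \<bullet> S b)"
    by (simp add: a'_def b'_def linear_cmul[OF S] linear_cmul[OF T] algebra_simps)
  finally have "(p * r) * \<bar>T a \<bullet> T b - S a \<bullet> S b\<bar> \<le> (p * r) * (\<epsilon> * p * r)"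
    using \<open>p * r > 0\<close> by (simp add: abs_mult[of "p * r"] abs_mult[of 4])
  then show ?thesis
    using \<open>p * r > 0\<close> by (simp only: mult_le_cancel_left_pos p_def r_def)
qed

text \<open>In the denominator, 1 - \<epsilon> comes from the lower embedding bound on the error and
  the subtracted quotient from the Lipschitz bound on \<open>g\<close>; the numerator \<epsilon>
  comes from the cross term.\<close>

lemma sketched_zero_bound:
  fixes X :: "real^'d^'n" and Y :: "real^'d^'m" and g :: "real^'d \<Rightarrow> real^'d"
  assumes lip: "\<And>x y. norm (g x - g y) \<le> L * norm (x - y)"
    and near: "\<And>v. \<bar>(norm (Y *v v))\<^sup>2 - (norm (X *v v))\<^sup>2\<bar> \<le> \<epsilon> * (norm (X *v v))\<^sup>2"
    and \<epsilon>: "0 < \<epsilon>" "\<epsilon> < 1 - L / (sigma_min X)\<^sup>2" and L: "0 \<le> L" "L < (sigma_min X)\<^sup>2"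
    and s: "transpose X *v (X *v \<beta>s - y) + g \<beta>s = 0"
    and t: "transpose Y *v (Y *v \<beta>t) - transpose X *v y + g \<beta>t = 0"
  shows "data_norm X (\<beta>t - \<beta>s) \<le> \<epsilon> / ((1 - \<epsilon>) - L / (sigma_min X)\<^sup>2) * data_norm X \<beta>s"
proof -
  define \<Delta> where "\<Delta> = \<beta>t - \<beta>s"
  define N where "N = norm (X *v \<Delta>)"
  define M where "M = norm (X *v \<beta>s)"
  define k where "k = L / (sigma_min X)\<^sup>2"
  have "transpose Y *v (Y *v \<beta>t) - transpose X *v (X *v \<beta>s) = g \<beta>s - g \<beta>t"
    using s t by (simp add: matrix_vector_mult_diff_distrib algebra_simps)
  then have "(transpose Y *v (Y *v \<beta>t)) \<bullet> \<Delta> - (transpose X *v (X *v \<beta>s)) \<bullet> \<Delta> = (g \<beta>s - g \<beta>t) \<bullet> \<Delta>"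
    by (metis inner_diff_left)
  \<comment> \<open>Splitting off the error isolates its squared sketched norm and leaves a
    difference of inner products to which \<open>near_isometry_inner\<close> applies.\<close>
  moreover have "Y *v \<beta>t = Y *v \<Delta> + Y *v \<beta>s"
    by (simp add: \<Delta>_def matrix_vector_mult_diff_distrib)
  ultimately have eq: "(norm (Y *v \<Delta>))\<^sup>2 + ((Y *v \<beta>s) \<bullet> (Y *v \<Delta>) - (X *v \<beta>s) \<bullet> (X *v \<Delta>))
      = (g \<beta>s - g \<beta>t) \<bullet> \<Delta>"
    by (simp add: inner_transpose_mult power2_norm_eq_inner inner_add_left
        del: transpose_matrix_vector)
  have "(g \<beta>s - g \<beta>t) \<bullet> \<Delta> \<le> norm (g \<beta>s - g \<beta>t) * norm \<Delta>"
    by (rule norm_cauchy_schwarz)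
  also have "\<dots> \<le> L * norm \<Delta> * norm \<Delta>"
    using lip[of \<beta>s \<beta>t] by (intro mult_right_mono) (simp_all add: \<Delta>_def norm_minus_commute)
  also have "\<dots> = k * ((sigma_min X)\<^sup>2 * (norm \<Delta>)\<^sup>2)"
    using L by (auto simp: k_def power2_eq_square)
  also have "\<dots> \<le> k * N\<^sup>2"
    unfolding N_def using L by (intro mult_left_mono sigma_min_le) (simp add: k_def)
  finally have 1: "(g \<beta>s - g \<beta>t) \<bullet> \<Delta> \<le> k * N\<^sup>2" .
  have 2: "\<bar>(Y *v \<beta>s) \<bullet> (Y *v \<Delta>) - (X *v \<beta>s) \<bullet> (X *v \<Delta>)\<bar> \<le> \<epsilon> * M * N"
    unfolding M_def N_def using near by (intro near_isometry_inner) auto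
  have 3: "(norm (Y *v \<Delta>))\<^sup>2 \<ge> N\<^sup>2 - \<epsilon> * N\<^sup>2"
    using near[of \<Delta>] by (simp add: N_def abs_le_iff)
  have "(1 - \<epsilon> - k) * N * N \<le> \<epsilon> * M * N"
    using eq 1 2 3 by (simp add: algebra_simps power2_eq_square)
  \<comment> \<open>One factor \<open>N\<close> is cancelled; if \<open>N\<close> is 0, the claim
    only says that the right side is nonnegative.\<close>
  then have "(1 - \<epsilon> - k) * N \<le> \<epsilon> * M"
    using \<epsilon> by (cases "N = 0") (auto simp: N_def M_def)
  then show ?thesis
    using \<epsilon> unfolding data_norm_def k_def[symmetric] \<Delta>_def[symmetric] N_def[symmetric] M_def[symmetric]
    by (simp add: field_simps)
qed

section \<open>Measurability of the event\<close>

text \<open>Projections of Borel sets need not be Borel. Here the open set is a countable union of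
  compact sets, each meets the closed set in a compact set, and projection keeps
  compactness.\<close>

lemma borel_projection_closed_Int_open:
  fixes C U :: "('a::euclidean_space \<times> 'b::euclidean_space) set"
  assumes "closed C" "open U"
  shows "fst ` (C \<inter> U) \<in> sets borel"
proof -
  obtain F :: "nat \<Rightarrow> ('a \<times> 'b) set" where F: "\<And>n. compact (F n)" "(\<Union>n. F n) = U"
    using open_Union_compact_subsets[OF \<open>open U\<close>] by metis
  have "fst ` (C \<inter> U) = (\<Union>n. fst ` (C \<inter> F n))"
    using F(2) by blast
  moreover have "compact (fst ` (C \<inter> F n))" for n
    by (intro compact_continuous_image continuous_intros closed_Int_compact assms F)
  then have "(\<Union>n. fst ` (C \<inter> F n)) \<in> sets borel"
    by (intro sets.countable_UN) (auto intro: borel_compact)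
  ultimately show ?thesis by simp
qed

text \<open>The event fails at \<open>P\<close> when some zero of the equation, a closed condition
  on the pair, violates the bound, an open condition; the complement is thus a projection of the
  kind just treated.\<close>

lemma borel_sketched_zero_bound:
  fixes X :: "real^'d^'n" and y :: "real^'n" and g :: "real^'d \<Rightarrow> real^'d"
  assumes g: "continuous_on UNIV g"
  shows "{P :: real^'n^'m. \<forall>\<beta>. transpose (P ** X) *v ((P ** X) *v \<beta>) - transpose X *v y + g \<beta> = 0 \<longrightarrow>
     data_norm X (\<beta> - \<beta>s) \<le> c} \<in> sets borel"
proof -
  define C :: "((real^'n^'m) \<times> (real^'d)) set" where
    "C = {z. transpose (fst z ** X) *v ((fst z ** X) *v snd z) - transpose X *v y + g (snd z) = 0}"
  define U :: "((real^'n^'m) \<times> (real^'d)) set" where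
    "U = {z. c < norm (X *v (snd z - \<beta>s))}"
  have "closed C"
    unfolding C_def
    by (intro closed_Collect_eq continuous_on_add continuous_on_diff continuous_on_matrix_vector_mult
        continuous_on_transpose continuous_on_matrix_matrix_mult continuous_on_const
        continuous_on_fst continuous_on_snd continuous_on_id
        continuous_on_compose2[OF g]) auto
  moreover have "open U"
    unfolding U_def
    by (intro open_Collect_less continuous_on_norm continuous_on_diff continuous_on_matrix_vector_mult
        continuous_on_const continuous_on_snd continuous_on_id)
  ultimately have "fst ` (C \<inter> U) \<in> sets borel"
    by (rule borel_projection_closed_Int_open)
  then have "- (fst ` (C \<inter> U)) \<in> sets borel"
    by (simp add: borel_comp)
  moreover have "fst ` (C \<inter> U) = {P. \<exists>\<beta>. (P, \<beta>) \<in> C \<and> (P, \<beta>) \<in> U}"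
    by force
  then have "- (fst ` (C \<inter> U)) = {P. \<forall>\<beta>. transpose (P ** X) *v ((P ** X) *v \<beta>) - transpose X *v y + g \<beta> = 0 \<longrightarrow>
     data_norm X (\<beta> - \<beta>s) \<le> c}"
    by (auto simp: C_def U_def data_norm_def not_less simp del: transpose_matrix_vector)
  ultimately show ?thesis by simp
qed

section \<open>The probabilistic bound\<close>

text \<open>The quantifier over \<beta>t lies inside the event because the sketched critical points
  depend on \<open>P\<close>, whereas \<beta>s is fixed before \<open>P\<close> is drawn.\<close>

theorem mainTheorem2:
  fixes X :: "real^'d^'n" and y :: "real^'n" and h :: "real^'d \<Rightarrow> real"
    and D :: "(real^'n^'m) measure"
    and L \<epsilon> \<epsilon>\<^sub>0 \<delta> :: real and \<beta>s :: "real^'d"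
  assumes "rank X = CARD('d)"
    and "\<not> convex_on UNIV h"
    and "frechet_subdifferentiable h"
    and "smooth_frechet_subdifferential L h"
    and "0 < \<epsilon>" and "\<epsilon> < \<epsilon>\<^sub>0" and "\<epsilon>\<^sub>0 < 1"
    and "0 < \<delta>" and "\<delta> < 1"
    and "oblivious_subspace_embedding \<epsilon> \<delta> TYPE('d) D"
    and "critical_point (objective X y h) \<beta>s"
    and "(sigma_min X)\<^sup>2 > L"
    and "\<epsilon> < 1 - L / (sigma_min X)\<^sup>2"
  shows "\<P>(P in D. \<forall>\<beta>t. critical_point (sketched_objective (P ** X) X y h) \<beta>t \<longrightarrow>
           data_norm X (\<beta>t - \<beta>s) \<le> \<epsilon> / ((1 - \<epsilon>) - L / (sigma_min X)\<^sup>2) * data_norm X \<beta>s)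
         \<ge> 1 - \<delta>"
proof -
  obtain g where g: "\<And>x. frechet_subdifferential h x = {g x}"
    and lip: "\<And>x y. norm (g x - g y) \<le> L * norm (x - y)"
    using smooth_frechet_subdifferential_singleton[OF assms(3,4)] by blast
  \<comment> \<open>Two points at distance 1 turn the Lipschitz estimate into nonnegativity of
    \<open>L\<close>.\<close>
  have "0 \<le> L * norm (axis undefined 1 - 0 :: real^'d)"
    using lip norm_ge_zero order_trans by blast
  then have L: "0 \<le> L" by simp
  have "L-lipschitz_on UNIV g"
    using lip L by (auto simp: lipschitz_on_def dist_norm)
  then have g_cont: "continuous_on UNIV g"
    by (rule lipschitz_on_continuous_on)
  have s: "transpose X *v (X *v \<beta>s - y) + g \<beta>s = 0"
    using assms(11) critical_point_objective_iff[OF g g_cont] by blast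
  note crit = critical_point_sketched_objective_iff[OF g g_cont]
  interpret D: prob_space D
    using assms(10) by (simp add: oblivious_subspace_embedding_def)
  have sets: "sets D = sets borel"
    using assms(10) by (simp add: oblivious_subspace_embedding_def)
  then have space: "space D = UNIV"
    using sets_eq_imp_space_eq by fastforce
  let ?emb = "\<lambda>P. \<forall>\<beta>. (1 - \<epsilon>) * (norm (X *v \<beta>))\<^sup>2 \<le> (norm ((P ** X) *v \<beta>))\<^sup>2 \<and>
                      (norm ((P ** X) *v \<beta>))\<^sup>2 \<le> (1 + \<epsilon>) * (norm (X *v \<beta>))\<^sup>2"
  have "1 - \<delta> \<le> \<P>(P in D. ?emb P)"
    using assms(10) by (simp add: oblivious_subspace_embedding_def)
  also have "\<dots> \<le> \<P>(P in D. \<forall>\<beta>t. critical_point (sketched_objective (P ** X) X y h) \<beta>t \<longrightarrow>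
           data_norm X (\<beta>t - \<beta>s) \<le> \<epsilon> / ((1 - \<epsilon>) - L / (sigma_min X)\<^sup>2) * data_norm X \<beta>s)"
  \<comment> \<open>Monotonicity asks that the larger event be measurable, which is what the
    projection argument provides.\<close>
  proof (rule D.finite_measure_mono)
    show "{P \<in> space D. \<forall>\<beta>t. critical_point (sketched_objective (P ** X) X y h) \<beta>t \<longrightarrow>
           data_norm X (\<beta>t - \<beta>s) \<le> \<epsilon> / ((1 - \<epsilon>) - L / (sigma_min X)\<^sup>2) * data_norm X \<beta>s} \<in> sets D"
      using borel_sketched_zero_bound[OF g_cont] by (simp add: crit sets space)
    have "data_norm X (\<beta>t - \<beta>s) \<le> \<epsilon> / ((1 - \<epsilon>) - L / (sigma_min X)\<^sup>2) * data_norm X \<beta>s"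
      if P: "?emb P" and t: "critical_point (sketched_objective (P ** X) X y h) \<beta>t" for P \<beta>t
    proof (rule sketched_zero_bound[OF lip _ assms(5,13) L assms(12) s])
      show "\<bar>(norm ((P ** X) *v v))\<^sup>2 - (norm (X *v v))\<^sup>2\<bar> \<le> \<epsilon> * (norm (X *v v))\<^sup>2" for v
        using P[rule_format, of v] by (auto simp: abs_le_iff algebra_simps)
      show "transpose (P ** X) *v ((P ** X) *v \<beta>t) - transpose X *v y + g \<beta>t = 0"
        using t crit by blast
    qed
    then show "{P \<in> space D. ?emb P} \<subseteq> {P \<in> space D. \<forall>\<beta>t. critical_point (sketched_objective (P ** X) X y h) \<beta>t \<longrightarrow>
           data_norm X (\<beta>t - \<beta>s) \<le> \<epsilon> / ((1 - \<epsilon>) - L / (sigma_min X)\<^sup>2) * data_norm X \<beta>s}"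
      by blast
  qed
  finally show ?thesis .
qed

end
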